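(* Let $A$ be a right coherent ring. Then the polynomial ring $A[X]$ in one variable, with the grading $\deg X = 1$ (so that $A$ is in degree $0$), is graded right coherent.
   Context: Modules are right modules and graded means $\mathbb{Z}$-graded. A module (resp. graded module) $M$ over a ring (resp. graded ring) $R$ is called coherent (resp. graded coherent) if (i) $M$ is finitely generated over $R$, and (ii) for every $R$-homomorphism (resp. graded, i.e. degree-preserving, $R$-homomorphism) $f: P \to M$ with $P$ a finitely generated free $R$-module (resp. a finitely generated graded free $R$-module, i.e. a finite direct sum of degree shifts of $R$), the kernel $\ker(f)$ is finitely generated over $R$. A ring (resp. graded ring) $R$ is called right coherent (resp. graded right coherent) if the regular right module $R_R$ is coherent (resp. graded coherent). *)

theory Defs
  imports "HOL-Algebra.UnivPoly"
begin

section \<open>Right modules\<close>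

text \<open>As for the record \<^typ>\<open>('a, 'b) module\<close> of HOL-Algebra, the fields \<^const>\<open>mult\<close> and
  \<^const>\<open>one\<close> of the module part play no role. The base ring need not be commutative.\<close>

record ('a, 'b) rmodule = "'b ring" +
  rsmult :: "'b \<Rightarrow> 'a \<Rightarrow> 'b" (infixl \<open>\<odot>\<^sub>r\<index>\<close> 70)

locale right_module = R?: ring R + M?: abelian_group M
  for R :: "('a, 'm) ring_scheme" (structure)
    and M :: "('a, 'b, 'k) rmodule_scheme" (structure) +
  assumes rsmult_closed: "\<lbrakk>x \<in> carrier M; a \<in> carrier R\<rbrakk> \<Longrightarrow> x \<odot>\<^sub>r\<^bsub>M\<^esub> a \<in> carrier M"
    and rsmult_add_left: "\<lbrakk>x \<in> carrier M; y \<in> carrier M; a \<in> carrier R\<rbrakk>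
      \<Longrightarrow> (x \<oplus>\<^bsub>M\<^esub> y) \<odot>\<^sub>r\<^bsub>M\<^esub> a = x \<odot>\<^sub>r\<^bsub>M\<^esub> a \<oplus>\<^bsub>M\<^esub> y \<odot>\<^sub>r\<^bsub>M\<^esub> a"
    and rsmult_add_right: "\<lbrakk>x \<in> carrier M; a \<in> carrier R; b \<in> carrier R\<rbrakk>
      \<Longrightarrow> x \<odot>\<^sub>r\<^bsub>M\<^esub> (a \<oplus>\<^bsub>R\<^esub> b) = x \<odot>\<^sub>r\<^bsub>M\<^esub> a \<oplus>\<^bsub>M\<^esub> x \<odot>\<^sub>r\<^bsub>M\<^esub> b"
    and rsmult_assoc: "\<lbrakk>x \<in> carrier M; a \<in> carrier R; b \<in> carrier R\<rbrakk>
      \<Longrightarrow> x \<odot>\<^sub>r\<^bsub>M\<^esub> (a \<otimes>\<^bsub>R\<^esub> b) = x \<odot>\<^sub>r\<^bsub>M\<^esub> a \<odot>\<^sub>r\<^bsub>M\<^esub> b"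
    and rsmult_one: "x \<in> carrier M \<Longrightarrow> x \<odot>\<^sub>r\<^bsub>M\<^esub> \<one>\<^bsub>R\<^esub> = x"

definition right_submodule ::
    "('a, 'm) ring_scheme \<Rightarrow> ('a, 'b, 'k) rmodule_scheme \<Rightarrow> 'b set \<Rightarrow> bool" where
  "right_submodule R M N \<longleftrightarrow> additive_subgroup N M \<and>
     (\<forall>x\<in>N. \<forall>a\<in>carrier R. x \<odot>\<^sub>r\<^bsub>M\<^esub> a \<in> N)"

definition rmod_span ::
    "('a, 'm) ring_scheme \<Rightarrow> ('a, 'b, 'k) rmodule_scheme \<Rightarrow> 'b set \<Rightarrow> 'b set" where
  "rmod_span R M S = \<Inter>{N. right_submodule R M N \<and> S \<subseteq> N}"

definition rmod_fin_gen ::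
    "('a, 'm) ring_scheme \<Rightarrow> ('a, 'b, 'k) rmodule_scheme \<Rightarrow> 'b set \<Rightarrow> bool" where
  "rmod_fin_gen R M N \<longleftrightarrow> (\<exists>S. finite S \<and> S \<subseteq> carrier M \<and> N = rmod_span R M S)"

definition rmod_hom :: "('a, 'm) ring_scheme \<Rightarrow> ('a, 'b, 'k) rmodule_scheme
    \<Rightarrow> ('a, 'c, 'l) rmodule_scheme \<Rightarrow> ('b \<Rightarrow> 'c) set" where
  "rmod_hom R P M = {f. f \<in> carrier P \<rightarrow> carrier M \<and>
     (\<forall>x\<in>carrier P. \<forall>y\<in>carrier P. f (x \<oplus>\<^bsub>P\<^esub> y) = f x \<oplus>\<^bsub>M\<^esub> f y) \<and>
     (\<forall>x\<in>carrier P. \<forall>a\<in>carrier R. f (x \<odot>\<^sub>r\<^bsub>P\<^esub> a) = f x \<odot>\<^sub>r\<^bsub>M\<^esub> a)}"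

definition regular_rmod :: "('a, 'm) ring_scheme \<Rightarrow> ('a, 'a) rmodule" where
  "regular_rmod R = \<lparr>carrier = carrier R, mult = mult R, one = one R,
     zero = zero R, add = add R, rsmult = mult R\<rparr>"

text \<open>The direct sum of \<open>n\<close> copies of the regular right module.\<close>

definition free_rmod :: "('a, 'm) ring_scheme \<Rightarrow> nat \<Rightarrow> ('a, nat \<Rightarrow> 'a) rmodule" where
  "free_rmod R n = \<lparr>carrier = {..<n} \<rightarrow>\<^sub>E carrier R, mult = undefined, one = undefined,
     zero = (\<lambda>j\<in>{..<n}. \<zero>\<^bsub>R\<^esub>),
     add = (\<lambda>v w. \<lambda>j\<in>{..<n}. v j \<oplus>\<^bsub>R\<^esub> w j),
     rsmult = (\<lambda>v a. \<lambda>j\<in>{..<n}. v j \<otimes>\<^bsub>R\<^esub> a)\<rparr>"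

text \<open>Every finitely generated free module is isomorphic to some \<^term>\<open>free_rmod R n\<close>, so it is
  enough to test coherence on these; this avoids quantifying over the type of the free module.\<close>

definition coherent_rmod ::
    "('a, 'm) ring_scheme \<Rightarrow> ('a, 'b, 'k) rmodule_scheme \<Rightarrow> bool" where
  "coherent_rmod R M \<longleftrightarrow> right_module R M \<and> rmod_fin_gen R M (carrier M) \<and>
     (\<forall>n. \<forall>f\<in>rmod_hom R (free_rmod R n) M.
        rmod_fin_gen R (free_rmod R n) (a_kernel (free_rmod R n) M f))"

definition right_coherent_ring :: "('a, 'm) ring_scheme \<Rightarrow> bool" where
  "right_coherent_ring R \<longleftrightarrow> ring R \<and> coherent_rmod R (regular_rmod R)"

section \<open>Graded rings and graded right modules\<close>

text \<open>A \<open>\<int>\<close>-grading is given by the function sending a degree to its homogeneous component.\<close>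

definition direct_sum_decomp :: "('b, 'm) ring_scheme \<Rightarrow> (int \<Rightarrow> 'b set) \<Rightarrow> bool" where
  "direct_sum_decomp M H \<longleftrightarrow> (\<forall>k. additive_subgroup (H k) M) \<and>
     (\<forall>x\<in>carrier M. \<exists>!c. (\<forall>k. c k \<in> H k) \<and> finite {k. c k \<noteq> \<zero>\<^bsub>M\<^esub>} \<and>
        x = (\<Oplus>\<^bsub>M\<^esub>k\<in>{k. c k \<noteq> \<zero>\<^bsub>M\<^esub>}. c k))"

definition graded_ring :: "('a, 'm) ring_scheme \<Rightarrow> (int \<Rightarrow> 'a set) \<Rightarrow> bool" where
  "graded_ring R G \<longleftrightarrow> ring R \<and> direct_sum_decomp R G \<and> \<one>\<^bsub>R\<^esub> \<in> G 0 \<and>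
     (\<forall>k l. \<forall>a\<in>G k. \<forall>b\<in>G l. a \<otimes>\<^bsub>R\<^esub> b \<in> G (k + l))"

definition graded_rmod :: "('a, 'm) ring_scheme \<Rightarrow> (int \<Rightarrow> 'a set)
    \<Rightarrow> ('a, 'b, 'k) rmodule_scheme \<Rightarrow> (int \<Rightarrow> 'b set) \<Rightarrow> bool" where
  "graded_rmod R G M H \<longleftrightarrow> graded_ring R G \<and> right_module R M \<and> direct_sum_decomp M H \<and>
     (\<forall>k l. \<forall>x\<in>H k. \<forall>a\<in>G l. x \<odot>\<^sub>r\<^bsub>M\<^esub> a \<in> H (k + l))"

definition degree_shift :: "(int \<Rightarrow> 'b set) \<Rightarrow> int \<Rightarrow> int \<Rightarrow> 'b set" where
  "degree_shift H d k = H (k + d)"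

text \<open>The grading of \<^term>\<open>free_rmod R n\<close> as the direct sum over \<open>j < n\<close> of the shifts of the
  regular module by \<open>d j\<close>.\<close>

definition free_grading :: "(int \<Rightarrow> 'a set) \<Rightarrow> nat \<Rightarrow> (nat \<Rightarrow> int) \<Rightarrow> int \<Rightarrow> (nat \<Rightarrow> 'a) set" where
  "free_grading G n d k = (\<Pi>\<^sub>E j\<in>{..<n}. degree_shift G (d j) k)"

definition graded_rmod_hom :: "('a, 'm) ring_scheme
    \<Rightarrow> ('a, 'b, 'k) rmodule_scheme \<Rightarrow> (int \<Rightarrow> 'b set)
    \<Rightarrow> ('a, 'c, 'l) rmodule_scheme \<Rightarrow> (int \<Rightarrow> 'c set) \<Rightarrow> ('b \<Rightarrow> 'c) set" where
  "graded_rmod_hom R P K M H = {f \<in> rmod_hom R P M. \<forall>k. f ` K k \<subseteq> H k}"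

definition graded_coherent_rmod :: "('a, 'm) ring_scheme \<Rightarrow> (int \<Rightarrow> 'a set)
    \<Rightarrow> ('a, 'b, 'k) rmodule_scheme \<Rightarrow> (int \<Rightarrow> 'b set) \<Rightarrow> bool" where
  "graded_coherent_rmod R G M H \<longleftrightarrow> graded_rmod R G M H \<and> rmod_fin_gen R M (carrier M) \<and>
     (\<forall>n d. \<forall>f\<in>graded_rmod_hom R (free_rmod R n) (free_grading G n d) M H.
        rmod_fin_gen R (free_rmod R n) (a_kernel (free_rmod R n) M f))"

definition graded_right_coherent_ring ::
    "('a, 'm) ring_scheme \<Rightarrow> (int \<Rightarrow> 'a set) \<Rightarrow> bool" where
  "graded_right_coherent_ring R G \<longleftrightarrow>
     graded_ring R G \<and> graded_coherent_rmod R G (regular_rmod R) G"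

section \<open>The grading of a polynomial ring by degree\<close>

text \<open>\<^term>\<open>UP A\<close> is the ring of polynomials over a not necessarily commutative ring \<open>A\<close>, in a
  variable commuting with the coefficients.\<close>

definition UP_grading :: "('a, 'm) ring_scheme \<Rightarrow> int \<Rightarrow> (nat \<Rightarrow> 'a) set" where
  "UP_grading A k =
     (if k < 0 then {\<zero>\<^bsub>UP A\<^esub>} else {monom (UP A) a (nat k) | a. a \<in> carrier A})"

end

theory Submission
  imports Defs
begin

text \<open>A graded homomorphism from a finite free module to \<open>A[X]\<close> sends the \<open>j\<close>-th basis vector to a
  monomial \<open>a j X ^ m j\<close>. In degree \<open>k\<close>, its kernel is the kernel of the homomorphism
  \<open>b \<mapsto> \<Sum>j. a j b j\<close> on the free \<open>A\<close>-module with basis \<open>{j. m j \<le> k}\<close>, hence finitely generated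
  over the coherent ring \<open>A\<close>. These homomorphisms do not change once \<open>k\<close> exceeds all \<open>m j\<close>, so beyond that degree the
  kernel is generated by multiplication with powers of \<open>X\<close>, and finitely many degrees suffice.\<close>

section \<open>Right modules\<close>

context right_module
begin

lemma rsmult_zero:
  assumes "x \<in> carrier M" shows "x \<odot>\<^sub>r\<^bsub>M\<^esub> \<zero>\<^bsub>R\<^esub> = \<zero>\<^bsub>M\<^esub>"
proof -
  have "x \<odot>\<^sub>r\<^bsub>M\<^esub> \<zero>\<^bsub>R\<^esub> \<oplus>\<^bsub>M\<^esub> x \<odot>\<^sub>r\<^bsub>M\<^esub> \<zero>\<^bsub>R\<^esub> = x \<odot>\<^sub>r\<^bsub>M\<^esub> \<zero>\<^bsub>R\<^esub>"
    using assms by (simp flip: rsmult_add_right)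
  then show ?thesis
    using assms by (simp add: rsmult_closed)
qed

lemma rsmult_minus_one:
  assumes "x \<in> carrier M" shows "x \<odot>\<^sub>r\<^bsub>M\<^esub> (\<ominus>\<^bsub>R\<^esub> \<one>\<^bsub>R\<^esub>) = \<ominus>\<^bsub>M\<^esub> x"
proof -
  have "x \<odot>\<^sub>r\<^bsub>M\<^esub> (\<ominus>\<^bsub>R\<^esub> \<one>\<^bsub>R\<^esub>) \<oplus>\<^bsub>M\<^esub> x = x \<odot>\<^sub>r\<^bsub>M\<^esub> (\<ominus>\<^bsub>R\<^esub> \<one>\<^bsub>R\<^esub> \<oplus>\<^bsub>R\<^esub> \<one>\<^bsub>R\<^esub>)"
    using assms by (simp add: rsmult_add_right rsmult_one)
  also have "\<dots> = \<zero>\<^bsub>M\<^esub>"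
    using assms by (simp add: R.l_neg rsmult_zero)
  finally show ?thesis
    using assms by (simp add: M.minus_equality rsmult_closed)
qed

text \<open>Closure under negation comes for free, since \<open>-x\<close> is the product of
  \<open>x\<close> with the scalar \<open>-1\<close>.\<close>

lemma right_submoduleI:
  assumes sub: "N \<subseteq> carrier M" and zero: "\<zero>\<^bsub>M\<^esub> \<in> N"
    and add: "\<And>x y. x \<in> N \<Longrightarrow> y \<in> N \<Longrightarrow> x \<oplus>\<^bsub>M\<^esub> y \<in> N"
    and smult: "\<And>x a. x \<in> N \<Longrightarrow> a \<in> carrier R \<Longrightarrow> x \<odot>\<^sub>r\<^bsub>M\<^esub> a \<in> N"
  shows "right_submodule R M N"
proof -
  have "\<ominus>\<^bsub>M\<^esub> x \<in> N" if "x \<in> N" for x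
    using smult[OF that, of "\<ominus>\<^bsub>R\<^esub> \<one>\<^bsub>R\<^esub>"] that sub by (auto simp: rsmult_minus_one)
  then have "additive_subgroup N M"
    using assms by (intro additive_subgroupI M.add.subgroupI) (auto simp: a_inv_def)
  then show ?thesis
    using smult by (simp add: right_submodule_def)
qed

end

lemma right_submoduleD:
  assumes "right_submodule R M N"
  shows "N \<subseteq> carrier M" "\<zero>\<^bsub>M\<^esub> \<in> N"
    "\<And>x y. x \<in> N \<Longrightarrow> y \<in> N \<Longrightarrow> x \<oplus>\<^bsub>M\<^esub> y \<in> N"
    "\<And>x a. x \<in> N \<Longrightarrow> a \<in> carrier R \<Longrightarrow> x \<odot>\<^sub>r\<^bsub>M\<^esub> a \<in> N"
  using assms additive_subgroup.a_subset additive_subgroup.zero_closed additive_subgroup.a_closed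
  unfolding right_submodule_def by fast+

lemma rmod_span_subset: "right_submodule R M N \<Longrightarrow> S \<subseteq> N \<Longrightarrow> rmod_span R M S \<subseteq> N"
  by (auto simp: rmod_span_def)

lemma rmod_span_superset: "S \<subseteq> rmod_span R M S"
  by (auto simp: rmod_span_def)

section \<open>Regular and free modules, linear forms\<close>

text \<open>For \<open>j \<ge> n\<close> this is the zero vector, so it lies in the free module for
  every \<open>j\<close>.\<close>

definition unit_vec :: "('a, 'm) ring_scheme \<Rightarrow> nat \<Rightarrow> nat \<Rightarrow> nat \<Rightarrow> 'a" where
  "unit_vec R n j = (\<lambda>i\<in>{..<n}. if i = j then \<one>\<^bsub>R\<^esub> else \<zero>\<^bsub>R\<^esub>)"

context ring
begin

lemma right_module_regular: "right_module R (regular_rmod R)"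
proof -
  have "abelian_group (regular_rmod R)"
    by (rule abelian_groupI) (auto simp: regular_rmod_def a_ac intro: l_neg)
  then show ?thesis
    by (intro right_module.intro ring_axioms right_module_axioms.intro)
      (auto simp: regular_rmod_def l_distr r_distr m_assoc)
qed

lemma right_module_free: "right_module R (free_rmod R n)"
proof -
  have "\<exists>y\<in>carrier (free_rmod R n). y \<oplus>\<^bsub>free_rmod R n\<^esub> x = \<zero>\<^bsub>free_rmod R n\<^esub>"
    if "x \<in> carrier (free_rmod R n)" for x
    using that by (intro bexI[of _ "\<lambda>j\<in>{..<n}. \<ominus> x j"])
      (auto simp: free_rmod_def PiE_iff l_neg fun_eq_iff)
  then have "abelian_group (free_rmod R n)"
    by (intro abelian_groupI)
      (auto simp: free_rmod_def PiE_iff a_ac extensional_def fun_eq_iff)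
  then show ?thesis
    by (intro right_module.intro ring_axioms right_module_axioms.intro)
      (auto simp: free_rmod_def PiE_iff l_distr r_distr m_assoc extensional_def fun_eq_iff)
qed

lemma rmod_fin_gen_regular: "rmod_fin_gen R (regular_rmod R) (carrier (regular_rmod R))"
proof -
  interpret M: right_module R "regular_rmod R" by (rule right_module_regular)
  have "x \<in> N" if N: "right_submodule R (regular_rmod R) N" "{\<one>} \<subseteq> N" and x: "x \<in> carrier R" for N x
    using right_submoduleD(4)[OF N(1), of "\<one>" x] N(2) x by (simp add: regular_rmod_def)
  moreover have "right_submodule R (regular_rmod R) (carrier R)"
    by (rule M.right_submoduleI) (auto simp: regular_rmod_def)
  ultimately have "carrier R = rmod_span R (regular_rmod R) {\<one>}"
    unfolding rmod_span_def by auto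
  then show ?thesis
    unfolding rmod_fin_gen_def by (intro exI[of _ "{\<one>}"]) (auto simp: regular_rmod_def)
qed

text \<open>Coefficients multiply from the left and scalars from the right, so associativity pulls a
  scalar out of every term.\<close>

lemma linear_combination_rmod_hom:
  assumes "\<And>j. j < n \<Longrightarrow> a j \<in> carrier R"
  shows "(\<lambda>v. \<Oplus>j\<in>{..<n}. a j \<otimes> v j) \<in> rmod_hom R (free_rmod R n) (regular_rmod R)"
proof -
  have add: "(\<Oplus>j\<in>{..<n}. a j \<otimes> (x \<oplus>\<^bsub>free_rmod R n\<^esub> y) j) =
      (\<Oplus>j\<in>{..<n}. a j \<otimes> x j) \<oplus> (\<Oplus>j\<in>{..<n}. a j \<otimes> y j)"
    if "x \<in> carrier (free_rmod R n)" "y \<in> carrier (free_rmod R n)" for x y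
  proof -
    have "(\<Oplus>j\<in>{..<n}. a j \<otimes> (x \<oplus>\<^bsub>free_rmod R n\<^esub> y) j) = (\<Oplus>j\<in>{..<n}. a j \<otimes> x j \<oplus> a j \<otimes> y j)"
      using that assms by (intro finsum_cong') (auto simp: free_rmod_def PiE_iff r_distr)
    then show ?thesis
      using that assms by (subst (asm) finsum_addf) (auto simp: free_rmod_def PiE_iff)
  qed
  have smult: "(\<Oplus>j\<in>{..<n}. a j \<otimes> (x \<odot>\<^sub>r\<^bsub>free_rmod R n\<^esub> c) j) = (\<Oplus>j\<in>{..<n}. a j \<otimes> x j) \<otimes> c"
    if "x \<in> carrier (free_rmod R n)" "c \<in> carrier R" for x c
  proof -
    have "(\<Oplus>j\<in>{..<n}. a j \<otimes> (x \<odot>\<^sub>r\<^bsub>free_rmod R n\<^esub> c) j) = (\<Oplus>j\<in>{..<n}. (a j \<otimes> x j) \<otimes> c)"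
      using that assms by (intro finsum_cong') (auto simp: free_rmod_def PiE_iff m_assoc)
    then show ?thesis
      using that assms by (subst finsum_ldistr) (auto simp: free_rmod_def PiE_iff)
  qed
  have "(\<Oplus>j\<in>{..<n}. a j \<otimes> x j) \<in> carrier R" if "x \<in> carrier (free_rmod R n)" for x
    using that assms by (intro finsum_closed) (auto simp: free_rmod_def PiE_iff)
  with add smult show ?thesis
    by (auto simp: rmod_hom_def regular_rmod_def)
qed

lemma unit_vec_closed: "unit_vec R n j \<in> carrier (free_rmod R n)"
  by (auto simp: unit_vec_def free_rmod_def)

lemma rmod_hom_free_eq_linear_combination:
  assumes f: "f \<in> rmod_hom R (free_rmod R n) (regular_rmod R)" and v: "v \<in> carrier (free_rmod R n)"
  shows "f v = (\<Oplus>j\<in>{..<n}. f (unit_vec R n j) \<otimes> v j)"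
proof -
  let ?F = "free_rmod R n"
  \<comment> \<open>Truncation to the first \<open>i\<close> coordinates. Induction on
    \<open>i\<close> adds one multiple of a basis vector at a time and ends with
    \<open>r n = v\<close>.\<close>
  define r where "r i = (\<lambda>j\<in>{..<n}. if j < i then v j else \<zero>)" for i
  have vj: "v j \<in> carrier R" if "j < n" for j
    using v that by (auto simp: free_rmod_def)
  have r: "r i \<in> carrier ?F" for i
    using vj by (auto simp: r_def free_rmod_def)
  have f_closed: "f x \<in> carrier R" if "x \<in> carrier ?F" for x
    using f that by (auto simp: rmod_hom_def regular_rmod_def)
  have f_add: "f (x \<oplus>\<^bsub>?F\<^esub> y) = f x \<oplus> f y" if "x \<in> carrier ?F" "y \<in> carrier ?F" for x y
    using f that by (auto simp: rmod_hom_def regular_rmod_def)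
  have f_smult: "f (x \<odot>\<^sub>r\<^bsub>?F\<^esub> a) = f x \<otimes> a" if "x \<in> carrier ?F" "a \<in> carrier R" for x a
    using f that by (auto simp: rmod_hom_def regular_rmod_def)
  have "f (r i) = (\<Oplus>j\<in>{..<i}. f (unit_vec R n j) \<otimes> v j)" if "i \<le> n" for i
    using that
  proof (induction i)
    case 0
    \<comment> \<open>Preservation of zero is not part of \<open>rmod_hom\<close>; here it follows
      from linearity for the scalar zero.\<close>
    have "r 0 \<odot>\<^sub>r\<^bsub>?F\<^esub> \<zero> = r 0"
      using vj by (auto simp: r_def free_rmod_def fun_eq_iff)
    then have "f (r 0) = f (r 0) \<otimes> \<zero>"
      using f_smult[OF r, of "\<zero>" 0] by simp
    then show ?case
      using f_closed[OF r] by simp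
  next
    case (Suc i)
    have "r (Suc i) = r i \<oplus>\<^bsub>?F\<^esub> (unit_vec R n i \<odot>\<^sub>r\<^bsub>?F\<^esub> v i)"
      using vj Suc.prems by (auto simp: r_def free_rmod_def unit_vec_def fun_eq_iff less_Suc_eq)
    moreover have "unit_vec R n i \<odot>\<^sub>r\<^bsub>?F\<^esub> v i \<in> carrier ?F"
      using right_module.rsmult_closed[OF right_module_free unit_vec_closed] vj Suc.prems by simp
    ultimately have "f (r (Suc i)) = f (r i) \<oplus> f (unit_vec R n i) \<otimes> v i"
      using vj Suc.prems by (simp add: f_add[OF r] f_smult unit_vec_closed)
    moreover have "(\<lambda>j. f (unit_vec R n j) \<otimes> v j) \<in> {..<i} \<rightarrow> carrier R"
      using vj Suc.prems f_closed[OF unit_vec_closed] by auto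
    ultimately show ?case
      using Suc vj f_closed[OF unit_vec_closed]
      by (simp add: lessThan_Suc a_comm)
  qed
  moreover have "r n = v"
    using v by (auto simp: r_def free_rmod_def PiE_iff extensional_def fun_eq_iff)
  ultimately show ?thesis by force
qed

lemma right_submodule_kernel_regular:
  assumes f: "f \<in> rmod_hom R M (regular_rmod R)" and M: "right_module R M"
  shows "right_submodule R M (a_kernel M (regular_rmod R) f)"
proof -
  interpret M: right_module R M by (rule M)
  have "f (\<zero>\<^bsub>M\<^esub> \<oplus>\<^bsub>M\<^esub> \<zero>\<^bsub>M\<^esub>) = f \<zero>\<^bsub>M\<^esub> \<oplus> f \<zero>\<^bsub>M\<^esub>" "f \<zero>\<^bsub>M\<^esub> \<in> carrier R"
    using f M.M.zero_closed unfolding rmod_hom_def regular_rmod_def by fastforce+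
  then have "f \<zero>\<^bsub>M\<^esub> = \<zero>" by simp
  with f show ?thesis
    by (intro M.right_submoduleI) (auto simp: a_kernel_def' rmod_hom_def regular_rmod_def M.rsmult_closed)
qed

end

section \<open>The polynomial ring as a graded ring\<close>

text \<open>The regular module is a different record with the same additive structure. Notions
  depending only on that structure are transferred here and in the next two lemmas.\<close>

lemma finsum_regular: "finsum (regular_rmod R) = finsum R"
  by (simp add: finsum_def finprod_def regular_rmod_def fun_eq_iff)

lemma additive_subgroup_regular: "additive_subgroup H (regular_rmod R) \<longleftrightarrow> additive_subgroup H R"
  by (simp add: additive_subgroup_def subgroup_def m_inv_def regular_rmod_def)

lemma direct_sum_decomp_regular: "direct_sum_decomp (regular_rmod R) G \<longleftrightarrow> direct_sum_decomp R G"
  unfolding direct_sum_decomp_def finsum_regular additive_subgroup_regular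
  by (simp add: regular_rmod_def)

lemma graded_rmod_regular: "graded_ring R G \<Longrightarrow> graded_rmod R G (regular_rmod R) G"
  by (simp add: graded_rmod_def graded_ring_def direct_sum_decomp_regular ring.right_module_regular)
    (simp add: regular_rmod_def)

context UP_ring
begin

text \<open>This form treats all degrees alike: for \<open>k < 0\<close> no index equals
  \<open>k\<close>, so every coefficient vanishes.\<close>

lemma mem_UP_grading_iff:
  "p \<in> UP_grading R k \<longleftrightarrow> p \<in> carrier P \<and> (\<forall>i. int i \<noteq> k \<longrightarrow> coeff P p i = \<zero>)" (is "?l \<longleftrightarrow> ?r")
proof
  assume ?l
  then show ?r
    by (auto simp: UP_grading_def simp flip: P_def split: if_splits)
next
  assume r: ?r
  show ?l
  proof (cases "k < 0")
    case True
    with r have "p = \<zero>\<^bsub>P\<^esub>"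
      by (intro up_eqI) auto
    with True show ?thesis
      by (simp add: UP_grading_def flip: P_def)
  next
    case False
    with r have "p = monom P (coeff P p (nat k)) (nat k)"
      by (intro up_eqI) auto
    with False r show ?thesis
      using coeff_closed by (fastforce simp: UP_grading_def simp flip: P_def)
  qed
qed

lemma coeff_finsum_UP_grading:
  assumes c: "\<And>k. c k \<in> UP_grading R k" and fin: "finite {k. c k \<noteq> \<zero>\<^bsub>P\<^esub>}"
  shows "coeff P (\<Oplus>\<^bsub>P\<^esub>k\<in>{k. c k \<noteq> \<zero>\<^bsub>P\<^esub>}. c k) i = coeff P (c (int i)) i"
proof -
  let ?K = "{k. c k \<noteq> \<zero>\<^bsub>P\<^esub>}"
  have closed: "c k \<in> carrier P" for k
    using c by (simp add: mem_UP_grading_iff)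
  have zero: "coeff P (c k) i = \<zero>" if "k \<noteq> int i" for k
    using c[of k] that by (simp add: mem_UP_grading_iff)
  have "coeff P (\<Oplus>\<^bsub>P\<^esub>k\<in>?K. c k) i = (\<Oplus>k\<in>?K. coeff P (c k) i)"
    using closed by (intro coeff_finsum fin) auto
  \<comment> \<open>The index \<open>int i\<close> may lie outside the support, so it is inserted
    with a zero summand before all other indices are dropped.\<close>
  also have "\<dots> = (\<Oplus>k\<in>insert (int i) ?K. coeff P (c k) i)"
    using closed fin by (intro R.add.finprod_mono_neutral_cong_left) auto
  also have "\<dots> = (\<Oplus>k\<in>{int i}. coeff P (c k) i)"
    using closed fin zero by (intro R.add.finprod_mono_neutral_cong_right) auto
  also have "\<dots> = coeff P (c (int i)) i"
    using closed by simp
  finally show ?thesis .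
qed

lemma direct_sum_decomp_UP: "direct_sum_decomp P (UP_grading R)"
  unfolding direct_sum_decomp_def
proof (intro conjI allI ballI)
  interpret P: ring P by (rule UP_ring)
  fix k
  show "additive_subgroup (UP_grading R k) P"
  proof (intro additive_subgroupI P.add.subgroupI)
    show "\<ominus>\<^bsub>P\<^esub> p \<in> UP_grading R k" if "p \<in> UP_grading R k" for p
      using that by (simp add: mem_UP_grading_iff)
    have "\<zero>\<^bsub>P\<^esub> \<in> UP_grading R k"
      by (simp add: mem_UP_grading_iff)
    then show "UP_grading R k \<noteq> {}" by auto
  qed (auto simp: mem_UP_grading_iff)
next
  interpret P: ring P by (rule UP_ring)
  fix x assume x: "x \<in> carrier P"
  \<comment> \<open>The components are the monomials of \<open>x\<close>; they vanish above its
    degree.\<close>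
  define c where "c k = (if k < 0 then \<zero>\<^bsub>P\<^esub> else monom P (coeff P x (nat k)) (nat k))" for k :: int
  have c: "c k \<in> UP_grading R k" for k
    using x by (auto simp: c_def mem_UP_grading_iff)
  have "c k = \<zero>\<^bsub>P\<^esub>" if "k \<notin> {0..int (deg R x)}" for k
    using that x deg_aboveD[of x "nat k"] by (auto simp: c_def)
  then have "{k. c k \<noteq> \<zero>\<^bsub>P\<^esub>} \<subseteq> {0..int (deg R x)}"
    by blast
  then have fin: "finite {k. c k \<noteq> \<zero>\<^bsub>P\<^esub>}"
    by (rule finite_subset) simp
  have sum_closed: "(\<Oplus>\<^bsub>P\<^esub>k\<in>{k. c k \<noteq> \<zero>\<^bsub>P\<^esub>}. c k) \<in> carrier P" if "\<And>k. c k \<in> UP_grading R k"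
    for c :: "int \<Rightarrow> _"
    using that by (intro P.finsum_closed) (auto simp: mem_UP_grading_iff)
  have x_eq: "x = (\<Oplus>\<^bsub>P\<^esub>k\<in>{k. c k \<noteq> \<zero>\<^bsub>P\<^esub>}. c k)"
    by (rule up_eqI) (use x coeff_finsum_UP_grading[OF c fin] sum_closed[OF c] in \<open>auto simp: c_def\<close>)
  \<comment> \<open>Uniqueness: summation fixes the coefficient of index \<open>i\<close> in the
    component of degree \<open>i\<close>, and homogeneity kills all others.\<close>
  have "c' = c" if c': "\<And>k. c' k \<in> UP_grading R k" and fin': "finite {k. c' k \<noteq> \<zero>\<^bsub>P\<^esub>}"
    and x_eq': "x = (\<Oplus>\<^bsub>P\<^esub>k\<in>{k. c' k \<noteq> \<zero>\<^bsub>P\<^esub>}. c' k)" for c'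
  proof
    fix k
    have "coeff P (c' (int i)) i = coeff P (c (int i)) i" for i
      using coeff_finsum_UP_grading[OF c fin] coeff_finsum_UP_grading[OF c' fin'] x_eq x_eq' by simp
    then have "coeff P (c' k) i = coeff P (c k) i" for i
      using c[of k] c'[of k] by (cases "k = int i") (auto simp: mem_UP_grading_iff)
    then show "c' k = c k"
      using c[of k] c'[of k] by (intro up_eqI) (auto simp: mem_UP_grading_iff)
  qed
  with c fin x_eq show "\<exists>!c. (\<forall>k. c k \<in> UP_grading R k) \<and> finite {k. c k \<noteq> \<zero>\<^bsub>P\<^esub>} \<and>
      x = (\<Oplus>\<^bsub>P\<^esub>k\<in>{k. c k \<noteq> \<zero>\<^bsub>P\<^esub>}. c k)"
    by (intro ex1I[of _ c]) auto
qed

lemma graded_ring_UP: "graded_ring P (UP_grading R)"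
  unfolding graded_ring_def
proof (intro conjI allI ballI)
  fix k l p q
  assume p: "p \<in> UP_grading R k" and q: "q \<in> UP_grading R l"
  \<comment> \<open>If \<open>i\<close> is not \<open>k + l\<close>, then
    \<open>j \<noteq> k\<close> or \<open>i - j \<noteq> l\<close>, so each term of the convolution
    has a zero factor.\<close>
  have "coeff P p j \<otimes> coeff P q (i - j) = \<zero>" if "int i \<noteq> k + l" "j \<le> i" for i j
    using p q that by (cases "int j = k") (auto simp: mem_UP_grading_iff)
  then show "p \<otimes>\<^bsub>P\<^esub> q \<in> UP_grading R (k + l)"
    using p q by (auto simp: mem_UP_grading_iff intro!: R.add.finprod_one_eqI)
qed (auto simp: UP_ring direct_sum_decomp_UP mem_UP_grading_iff)

section \<open>Homogeneous linear equations over the polynomial ring\<close>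

lemma coeff_monom_mult':
  assumes "c \<in> carrier R" "p \<in> carrier P"
  shows "coeff P (monom P c m \<otimes>\<^bsub>P\<^esub> p) k = (if m \<le> k then c \<otimes> coeff P p (k - m) else \<zero>)"
proof (cases "m \<le> k")
  case True
  then show ?thesis
    using coeff_monom_mult[OF assms, of m "k - m"] by simp
next
  case False
  have "(if m = i then c else \<zero>) \<otimes> coeff P p (k - i) = \<zero>" if "i \<le> k" for i
    using False that assms by auto
  then have "(\<Oplus>i\<in>{..k}. (if m = i then c else \<zero>) \<otimes> coeff P p (k - i)) = \<zero>"
    by (intro R.add.finprod_one_eqI) simp
  with False assms show ?thesis
    by simp
qed

section \<open>Homogeneous components in free modules\<close>

text \<open>Coordinates with \<open>m j > k\<close> are discarded, so that all degrees can be parametrised by the same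
  module \<^term>\<open>free_rmod R n\<close>.\<close>

definition homogeneous_vec :: "nat \<Rightarrow> (nat \<Rightarrow> nat) \<Rightarrow> nat \<Rightarrow> (nat \<Rightarrow> 'a) \<Rightarrow> nat \<Rightarrow> nat \<Rightarrow> 'a" where
  "homogeneous_vec n m k b = (\<lambda>j\<in>{..<n}. if m j \<le> k then monom P (b j) (k - m j) else \<zero>\<^bsub>P\<^esub>)"

text \<open>With the \<open>j\<close>-th basis vector placed in degree \<open>m j\<close>, applying
  \<open>homogeneous_vec n m k\<close> to this vector gives the degree \<open>k\<close> component of
  \<open>v\<close>.\<close>

definition coeff_vec :: "nat \<Rightarrow> (nat \<Rightarrow> nat) \<Rightarrow> nat \<Rightarrow> (nat \<Rightarrow> nat \<Rightarrow> 'a) \<Rightarrow> nat \<Rightarrow> 'a" where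
  "coeff_vec n m k v = (\<lambda>j\<in>{..<n}. if m j \<le> k then coeff P (v j) (k - m j) else \<zero>)"

lemma homogeneous_vec_closed:
  "b \<in> carrier (free_rmod R n) \<Longrightarrow> homogeneous_vec n m k b \<in> carrier (free_rmod P n)"
  by (auto simp: homogeneous_vec_def free_rmod_def PiE_iff)

lemma coeff_vec_closed:
  "v \<in> carrier (free_rmod P n) \<Longrightarrow> coeff_vec n m k v \<in> carrier (free_rmod R n)"
  by (auto simp: coeff_vec_def free_rmod_def PiE_iff)

lemma homogeneous_vec_zero:
  "homogeneous_vec n m k \<zero>\<^bsub>free_rmod R n\<^esub> = \<zero>\<^bsub>free_rmod P n\<^esub>"
  by (auto simp: homogeneous_vec_def free_rmod_def fun_eq_iff)

lemma homogeneous_vec_add: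
  assumes "b \<in> carrier (free_rmod R n)" "c \<in> carrier (free_rmod R n)"
  shows "homogeneous_vec n m k (b \<oplus>\<^bsub>free_rmod R n\<^esub> c) =
    homogeneous_vec n m k b \<oplus>\<^bsub>free_rmod P n\<^esub> homogeneous_vec n m k c"
proof -
  interpret P: ring P by (rule UP_ring)
  show ?thesis
    using assms by (intro ext) (auto simp: homogeneous_vec_def free_rmod_def PiE_iff)
qed

text \<open>The last hypothesis says that no new coordinate becomes active between degrees
  \<open>k\<close> and \<open>k + i\<close>. The case \<open>i = 0\<close> gives the action of
  constants, and \<open>c = \<one>\<close> gives multiplication by powers of the variable.\<close>

lemma homogeneous_vec_rsmult_monom:
  assumes "b \<in> carrier (free_rmod R n)" "c \<in> carrier R" and "\<And>j. j < n \<Longrightarrow> m j \<le> k + i \<longleftrightarrow> m j \<le> k"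
  shows "homogeneous_vec n m k b \<odot>\<^sub>r\<^bsub>free_rmod P n\<^esub> monom P c i =
    homogeneous_vec n m (k + i) (b \<odot>\<^sub>r\<^bsub>free_rmod R n\<^esub> c)"
proof -
  interpret P: ring P by (rule UP_ring)
  have "monom P (b j) (k - m j) \<otimes>\<^bsub>P\<^esub> monom P c i = monom P (b j \<otimes> c) (k + i - m j)"
    if "j < n" "m j \<le> k" for j
    using monom_mult[of "b j" c "k - m j" i] assms that by (simp add: free_rmod_def PiE_iff)
  with assms show ?thesis
    by (intro ext) (auto simp: homogeneous_vec_def free_rmod_def PiE_iff)
qed

text \<open>Multiplication by the \<open>j\<close>-th monomial shifts the coefficients of
  \<open>v j\<close> by \<open>m j\<close>, so coordinates with \<open>m j > k\<close> contribute
  nothing.\<close>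

lemma coeff_linear_combination:
  assumes a: "\<And>j. j < n \<Longrightarrow> a j \<in> carrier R" and v: "v \<in> carrier (free_rmod P n)"
  shows "coeff P (\<Oplus>\<^bsub>P\<^esub>j\<in>{..<n}. monom P (a j) (m j) \<otimes>\<^bsub>P\<^esub> v j) k =
    (\<Oplus>j\<in>{..<n}. (if m j \<le> k then a j else \<zero>) \<otimes> coeff_vec n m k v j)"
proof -
  have v: "v j \<in> carrier P" if "j < n" for j
    using v that by (auto simp: free_rmod_def)
  show ?thesis
    using a v by (subst coeff_finsum)
      (auto simp: coeff_vec_def coeff_monom_mult' simp del: coeff_mult intro!: R.finsum_cong')
qed

lemma linear_combination_homogeneous_vec:
  assumes a: "\<And>j. j < n \<Longrightarrow> a j \<in> carrier R" and b: "b \<in> carrier (free_rmod R n)"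
    and zero: "(\<Oplus>j\<in>{..<n}. (if m j \<le> k then a j else \<zero>) \<otimes> b j) = \<zero>"
  shows "(\<Oplus>\<^bsub>P\<^esub>j\<in>{..<n}. monom P (a j) (m j) \<otimes>\<^bsub>P\<^esub> homogeneous_vec n m k b j) = \<zero>\<^bsub>P\<^esub>"
proof (rule up_eqI)
  interpret P: ring P by (rule UP_ring)
  have bj: "b j \<in> carrier R" if "j < n" for j
    using b that by (auto simp: free_rmod_def)
  show "(\<Oplus>\<^bsub>P\<^esub>j\<in>{..<n}. monom P (a j) (m j) \<otimes>\<^bsub>P\<^esub> homogeneous_vec n m k b j) \<in> carrier P"
    using a bj by (intro P.finsum_closed) (auto simp: homogeneous_vec_def)
  fix i
  have "(\<Oplus>j\<in>{..<n}. (if m j \<le> i then a j else \<zero>) \<otimes> coeff_vec n m i (homogeneous_vec n m k b) j) = \<zero>"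
  proof (cases "i = k")
    case True
    \<comment> \<open>Passing to polynomials and back may change discarded coordinates, but their
      coefficients here are zero.\<close>
    have "(\<Oplus>j\<in>{..<n}. (if m j \<le> k then a j else \<zero>) \<otimes> coeff_vec n m k (homogeneous_vec n m k b) j) =
        (\<Oplus>j\<in>{..<n}. (if m j \<le> k then a j else \<zero>) \<otimes> b j)"
      using a bj by (intro R.finsum_cong') (auto simp: coeff_vec_def homogeneous_vec_def)
    with zero True show ?thesis by simp
  next
    case False
    have "coeff_vec n m i (homogeneous_vec n m k b) j = \<zero>" if "j < n" for j
      using False that bj by (auto simp: coeff_vec_def homogeneous_vec_def)
    with a show ?thesis
      by (intro R.add.finprod_one_eqI) auto
  qed
  then show "coeff P (\<Oplus>\<^bsub>P\<^esub>j\<in>{..<n}. monom P (a j) (m j) \<otimes>\<^bsub>P\<^esub> homogeneous_vec n m k b j) i =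
      coeff P \<zero>\<^bsub>P\<^esub> i"
    using coeff_linear_combination[OF a homogeneous_vec_closed[OF b], where m = m and k = i] by simp
qed simp

text \<open>\<open>v\<close> is the sum of finitely many of its homogeneous components.\<close>

lemma mem_right_submodule_of_homogeneous:
  assumes N: "right_submodule P (free_rmod P n) N" and v: "v \<in> carrier (free_rmod P n)"
    and homogeneous: "\<And>k. homogeneous_vec n m k (coeff_vec n m k v) \<in> N"
  shows "v \<in> N"
proof -
  interpret P: ring P by (rule UP_ring)
  \<comment> \<open>\<open>part D\<close> is the sum of the components of degree below
    \<open>D\<close>, so coefficient \<open>i\<close> of coordinate \<open>j\<close>, of degree
    \<open>i + m j\<close>, is present iff \<open>i + m j < D\<close>.\<close>
  define part where "part = rec_nat \<zero>\<^bsub>free_rmod P n\<^esub>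
    (\<lambda>k w. w \<oplus>\<^bsub>free_rmod P n\<^esub> homogeneous_vec n m k (coeff_vec n m k v))"
  have part_mem: "part D \<in> N" for D
    by (induction D) (auto simp: part_def right_submoduleD[OF N] homogeneous)
  then have part_closed: "part D \<in> carrier (free_rmod P n)" for D
    using right_submoduleD(1)[OF N] by auto
  have vj: "v j \<in> carrier P" if "j < n" for j
    using v that by (auto simp: free_rmod_def)
  have coeff_part: "coeff P (part D j) i = (if i + m j < D then coeff P (v j) i else \<zero>)"
    if "j < n" for D j i
  proof (induction D)
    case 0
    then show ?case
      using that by (simp add: part_def free_rmod_def)
  next
    case (Suc D)
    have "part D j \<in> carrier P"
      using part_closed[of D] that by (auto simp: free_rmod_def)
    moreover have "part (Suc D) j = part D j \<oplus>\<^bsub>P\<^esub> homogeneous_vec n m D (coeff_vec n m D v) j"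
      using that by (simp add: part_def free_rmod_def)
    ultimately show ?case
      using that vj[OF that] Suc by (auto simp: homogeneous_vec_def coeff_vec_def)
  qed
  \<comment> \<open>\<open>Suc\<close> makes this a strict bound on the degrees of all terms of
    \<open>v\<close>.\<close>
  define D where "D = Suc (\<Sum>j<n. deg R (v j) + m j)"
  have "deg R (v j) + m j < D" if "j < n" for j
    using member_le_sum[of j "{..<n}" "\<lambda>j. deg R (v j) + m j"] that by (simp add: D_def)
  then have "part D j = v j" if "j < n" for j
    using that vj[OF that] part_closed[of D] coeff_part[OF that, of D]
    by (intro up_eqI) (force simp: free_rmod_def intro: deg_aboveD[symmetric])+
  then have "part D = v"
    using v part_closed[of D]
    by (intro PiE_ext[of _ "{..<n}" "\<lambda>_. carrier P"]) (auto simp: free_rmod_def)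
  then show ?thesis
    using part_mem by metis
qed

section \<open>Finite generation of the kernel\<close>

lemma rmod_fin_gen_kernel_monomials:
  assumes coherent: "right_coherent_ring R" and a: "\<And>j. j < n \<Longrightarrow> a j \<in> carrier R"
  shows "rmod_fin_gen P (free_rmod P n)
    {v \<in> carrier (free_rmod P n). (\<Oplus>\<^bsub>P\<^esub>j\<in>{..<n}. monom P (a j) (m j) \<otimes>\<^bsub>P\<^esub> v j) = \<zero>\<^bsub>P\<^esub>}"
    (is "rmod_fin_gen P ?F ?K")
proof -
  interpret P: ring P by (rule UP_ring)
  interpret F: right_module R "free_rmod R n" by (rule R.right_module_free)
  \<comment> \<open>The equation in degree \<open>k\<close>; zero coefficients for inactive
    coordinates keep the domain independent of \<open>k\<close>.\<close>
  define g where "g k v = (\<Oplus>j\<in>{..<n}. (if m j \<le> k then a j else \<zero>) \<otimes> v j)" for k v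
  let ?Z = "\<lambda>k. a_kernel (free_rmod R n) (regular_rmod R) (g k)"
  have Z_iff: "b \<in> ?Z k \<longleftrightarrow> b \<in> carrier (free_rmod R n) \<and> g k b = \<zero>" for b k
    by (auto simp: a_kernel_def' regular_rmod_def)
  have "g k \<in> rmod_hom R (free_rmod R n) (regular_rmod R)" for k
    unfolding g_def using a by (intro R.linear_combination_rmod_hom) auto
  then have "\<exists>S. finite S \<and> S \<subseteq> carrier (free_rmod R n) \<and> ?Z k = rmod_span R (free_rmod R n) S" for k
    using coherent by (simp add: right_coherent_ring_def coherent_rmod_def rmod_fin_gen_def)
  then obtain S where S: "\<And>k. finite (S k)" "\<And>k. S k \<subseteq> carrier (free_rmod R n)"
      "\<And>k. ?Z k = rmod_span R (free_rmod R n) (S k)"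
    by metis
  \<comment> \<open>A common upper bound of the \<open>m j\<close>, valid also for
    \<open>n = 0\<close>; from degree \<open>N\<close> on all coordinates are active.\<close>
  define N where "N = (\<Sum>j<n. m j)"
  have m_le_N: "m j \<le> N" if "j < n" for j
    using that member_le_sum[of j "{..<n}" m] by (simp add: N_def)
  define T where "T = (\<Union>k\<le>N. homogeneous_vec n m k ` S k)"
  have finite_T: "finite T"
    using S(1) by (simp add: T_def)
  have "(\<lambda>v. \<Oplus>\<^bsub>P\<^esub>j\<in>{..<n}. monom P (a j) (m j) \<otimes>\<^bsub>P\<^esub> v j) \<in> rmod_hom P ?F (regular_rmod P)"
    using a by (intro P.linear_combination_rmod_hom) auto
  then have K_submodule: "right_submodule P ?F ?K"
    using P.right_submodule_kernel_regular P.right_module_free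
    by (fastforce simp: a_kernel_def' regular_rmod_def)
  have T_K: "T \<subseteq> ?K"
  proof
    fix v assume "v \<in> T"
    then obtain k b where v: "v = homogeneous_vec n m k b" and b: "b \<in> S k"
      by (auto simp: T_def)
    have "b \<in> ?Z k"
      using b S(3) rmod_span_superset by fast
    then show "v \<in> ?K"
      using linear_combination_homogeneous_vec[of n a b m k] a homogeneous_vec_closed
      by (simp add: v Z_iff g_def)
  qed
  \<comment> \<open>The span is an intersection of submodules, so containment of the kernel is
    tested against one arbitrary submodule \<open>L\<close> containing \<open>T\<close>.\<close>
  have K_least: "?K \<subseteq> L" if L: "right_submodule P ?F L" and "T \<subseteq> L" for L
  proof
    fix v assume v: "v \<in> ?K"
    have "homogeneous_vec n m k (coeff_vec n m k v) \<in> L" for k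
    proof -
      \<comment> \<open>Degrees above \<open>N\<close> are represented by \<open>N\<close>, where
        the same coordinates are active.\<close>
      define k0 where "k0 = min k N"
      have m_le: "m j \<le> k \<longleftrightarrow> m j \<le> k0" if "j < n" for j
        using m_le_N[OF that] by (auto simp: k0_def)
      \<comment> \<open>The preimage of \<open>L\<close> in degree \<open>k\<close>. It is an
        \<open>R\<close>-submodule, so containing the generators \<open>S k0\<close> forces it to
        contain all solutions in \<open>?Z k0\<close>.\<close>
      define B where "B = {b \<in> carrier (free_rmod R n). homogeneous_vec n m k b \<in> L}"
      have smult_B: "homogeneous_vec n m k (b \<odot>\<^sub>r\<^bsub>free_rmod R n\<^esub> c) \<in> L" if "b \<in> B" "c \<in> carrier R" for b c
        using right_submoduleD(4)[OF L, of "homogeneous_vec n m k b" "monom P c 0"] that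
          homogeneous_vec_rsmult_monom[of b n c m k 0]
        by (simp add: B_def)
      have "right_submodule R (free_rmod R n) B"
        using right_submoduleD[OF L] smult_B
        by (intro F.right_submoduleI)
          (auto simp: B_def homogeneous_vec_zero homogeneous_vec_add F.rsmult_closed)
      moreover have "S k0 \<subseteq> B"
      proof
        fix b assume b: "b \<in> S k0"
        with S(2) have b_closed: "b \<in> carrier (free_rmod R n)" by auto
        have "homogeneous_vec n m k0 b \<in> L"
          using b \<open>T \<subseteq> L\<close> min.cobounded2[of k N] unfolding T_def k0_def by blast
        \<comment> \<open>Multiplication by the power \<open>k - k0\<close> of the variable carries
          the generators from degree \<open>k0\<close> to degree \<open>k\<close>.\<close>
        moreover have "k0 + (k - k0) = k"
          by (simp add: k0_def)
        ultimately have "homogeneous_vec n m k b \<in> L"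
          using homogeneous_vec_rsmult_monom[OF b_closed R.one_closed, of m k0 "k - k0"] m_le
            right_submoduleD(4)[OF L, of "homogeneous_vec n m k0 b" "monom P \<one> (k - k0)"] b_closed
          by (simp add: F.rsmult_one)
        with b_closed show "b \<in> B" by (simp add: B_def)
      qed
      ultimately have "?Z k0 \<subseteq> B"
        unfolding S(3) by (rule rmod_span_subset)
      moreover have "coeff_vec n m k v \<in> ?Z k0"
      proof -
        \<comment> \<open>Both equations have the same coefficients, because the same coordinates
          are active in degrees \<open>k\<close> and \<open>k0\<close>.\<close>
        have "g k0 (coeff_vec n m k v) = g k (coeff_vec n m k v)"
          using a v coeff_vec_closed[of v n m k] unfolding g_def
          by (intro R.finsum_cong') (auto simp: m_le free_rmod_def)
        also have "\<dots> = \<zero>"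
          using coeff_linear_combination[of n a v m k] a v by (simp add: g_def)
        finally show ?thesis
          using v coeff_vec_closed by (simp add: Z_iff)
      qed
      ultimately show ?thesis by (auto simp: B_def)
    qed
    with v show "v \<in> L"
      using mem_right_submodule_of_homogeneous[OF L, of v m] by blast
  qed
  have "?K \<subseteq> rmod_span P ?F T"
    using K_least unfolding rmod_span_def by blast
  then have "?K = rmod_span P ?F T"
    using rmod_span_subset[OF K_submodule T_K] by (rule subset_antisym)
  with finite_T T_K show ?thesis
    unfolding rmod_fin_gen_def by blast
qed

section \<open>Reduction of graded homomorphisms to monomial linear forms\<close>

text \<open>The sign comes from the shift convention: \<open>\<one>\<close> has degree zero in the
  ring, and the shifted component of degree \<open>k\<close> is the original one of degree
  \<open>k + d j\<close>.\<close>

lemma unit_vec_homogeneous: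
  "j < n \<Longrightarrow> unit_vec P n j \<in> free_grading (UP_grading R) n d (- d j)"
  by (auto simp: unit_vec_def free_grading_def degree_shift_def mem_UP_grading_iff)

lemma graded_right_coherent_UP:
  assumes "right_coherent_ring R"
  shows "graded_right_coherent_ring P (UP_grading R)"
proof -
  interpret P: ring P by (rule UP_ring)
  have "rmod_fin_gen P (free_rmod P n) (a_kernel (free_rmod P n) (regular_rmod P) f)"
    if f: "f \<in> graded_rmod_hom P (free_rmod P n) (free_grading (UP_grading R) n d)
      (regular_rmod P) (UP_grading R)" for n d f
  proof -
    have f_hom: "f \<in> rmod_hom P (free_rmod P n) (regular_rmod P)"
      using f by (simp add: graded_rmod_hom_def)
    \<comment> \<open>If \<open>- d j\<close> is negative, \<open>nat\<close> returns 0; the image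
      of the basis vector then lies in a zero component, so \<open>a j\<close> is zero and the
      monomial form still holds.\<close>
    define m where "m j = nat (- d j)" for j
    define a where "a j = coeff P (f (unit_vec P n j)) (m j)" for j
    have f_unit: "f (unit_vec P n j) = monom P (a j) (m j)" and a: "a j \<in> carrier R" if "j < n" for j
    proof -
      have mem: "f (unit_vec P n j) \<in> UP_grading R (- d j)"
        using f unit_vec_homogeneous[OF that, of d] by (auto simp: graded_rmod_hom_def)
      then show a: "a j \<in> carrier R"
        by (simp add: a_def mem_UP_grading_iff)
      show "f (unit_vec P n j) = monom P (a j) (m j)"
        using mem a by (intro up_eqI) (auto simp: a_def m_def mem_UP_grading_iff)
    qed
    have "f v = (\<Oplus>\<^bsub>P\<^esub>j\<in>{..<n}. monom P (a j) (m j) \<otimes>\<^bsub>P\<^esub> v j)" if "v \<in> carrier (free_rmod P n)" for v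
      using that a unfolding P.rmod_hom_free_eq_linear_combination[OF f_hom that]
      by (intro P.finsum_cong') (auto simp: f_unit free_rmod_def)
    then have "a_kernel (free_rmod P n) (regular_rmod P) f =
        {v \<in> carrier (free_rmod P n). (\<Oplus>\<^bsub>P\<^esub>j\<in>{..<n}. monom P (a j) (m j) \<otimes>\<^bsub>P\<^esub> v j) = \<zero>\<^bsub>P\<^esub>}"
      by (auto simp: a_kernel_def' regular_rmod_def)
    with rmod_fin_gen_kernel_monomials[OF assms, of n a m] a show ?thesis by simp
  qed
  then show ?thesis
    by (auto simp: graded_right_coherent_ring_def graded_coherent_rmod_def graded_ring_UP
        graded_rmod_regular P.rmod_fin_gen_regular)
qed

end

theorem theorem1p1:
  fixes A :: "('a, 'm) ring_scheme"
  assumes "right_coherent_ring A"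
  shows "graded_right_coherent_ring (UP A) (UP_grading A)"
proof -
  interpret UP_ring A "UP A"
    using assms by (simp add: UP_ring_def right_coherent_ring_def)
  show ?thesis
    by (rule graded_right_coherent_UP[OF assms])
qed

end
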